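(* Let $\Delta$ be a thin chamber complex of rank $n$. Every distance normal geodesic of $\Gamma_{n-1}(\Delta)$ is contained in the $(n-1)$-shadow of a certain zigzag of $\Delta$, and the following assertions hold: (1) if this geodesic is of length $m\le n$, then there are at most $(n-m)!$ zigzags whose $(n-1)$-shadows contain the geodesic; (2) if the length of the geodesic is greater than $n$, then it is contained in the $(n-1)$-shadow of a unique zigzag. (Zigzags are counted up to cyclic permutation and reversal, as explained in the context.)
   Context: A simplicial complex $\Delta$ over a finite set $V$ is a family of subsets of $V$ (faces), closed under taking subsets and containing all one-element subsets. A $k$-face is a face with $k+1$ elements; $\emptyset$ is the unique $(-1)$-face; facets are maximal faces. $\Delta$ is assumed pure: all facets have the same cardinality $n$, the rank. $\Delta$ is thin if every ridge ($(n-2)$-face) lies in precisely two distinct facets. Two facets are adjacent if their intersection is a ridge. $\Gamma_{n-1}(\Delta)$ is the graph whose vertices are the facets and whose edges are the pairs of adjacent facets; $\Delta$ is a chamber complex if this graph is connected. $d$ denotes the path distance in $\Gamma_{n-1}(\Delta)$, and a geodesic is a path joining two vertices whose length is their distance. Flags and zigzags: a flag is a maximal chain $X_0\subset X_1\subset\dots\subset X_{n-1}$ with $X_i$ an $i$-face. For a flag $F$ and $i\in\{0,\dots,n-1\}$ let $\sigma_i(F)$ be the unique flag differing from $F$ precisely in its $i$-face. Put $T(F)=\sigma_{n-1}\cdots\sigma_1\sigma_0(F)$ ($\sigma_0$ applied first). A zigzag is a (periodic) sequence $\{T^i(F)\}_{i\in\mathbb N}$, where $\mathbb N\ni 0$.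 Zigzags differing by a cyclic permutation (i.e. starting from $T^j(F)$ instead of $F$) are identified. If $F$ is the flag $\{x_0\}\subset\{x_0,x_1\}\subset\dots\subset\{x_0,\dots,x_{n-1}\}$, its reverse $R(F)$ is the flag $\{x_{n-1}\}\subset\{x_{n-1},x_{n-2}\}\subset\dots\subset\{x_{n-1},\dots,x_0\}$. The reverse of a zigzag $F_1,\dots,F_l$ (one period listed) is the zigzag $R(F_l),\dots,R(F_1)$; every zigzag is identified with its reverse. The $(n-1)$-shadow of a zigzag $\{F_i\}_{i\in\mathbb N}$ is the sequence of facets $\{Y_i\}_{i\in\mathbb N}$ with $Y_i$ the facet in $F_i$; it is a closed path in $\Gamma_{n-1}(\Delta)$. A path $X_0,\dots,X_m$ is contained in $\{Y_i\}$ if there is $j$ with $Y_{j+i}=X_i$ for all $i\in\{0,\dots,m\}$. Distance normality: facets $X,Y$ with $d(X,Y)\le n$ form a distance normal pair if $d(X,Y)=n-|X\cap Y|$; in this case every geodesic joining $X$ and $Y$ is called distance normal. If $d(X,Y)>n$, a geodesic $X=X_0,X_1,\dots,X_m=Y$ is called distance normal if any two $X_i,X_j$ with $d(X_i,X_j)\le n$ form a distance normal pair. *)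

theory Defs
  imports Complex_Main
begin

section \<open>Thin chamber complexes\<close>

text \<open>The condition that the empty set is a face only matters for empty \<open>V\<close>.\<close>

definition simplicial_complex :: "'a set \<Rightarrow> 'a set set \<Rightarrow> bool" where
  "simplicial_complex V \<Delta> \<longleftrightarrow>
     finite V \<and> \<Delta> \<subseteq> Pow V \<and> {} \<in> \<Delta> \<and>
     (\<forall>X\<in>\<Delta>. \<forall>Y. Y \<subseteq> X \<longrightarrow> Y \<in> \<Delta>) \<and> (\<forall>v\<in>V. {v} \<in> \<Delta>)"

text \<open>The dimension is an integer, so that the empty face has dimension \<open>-1\<close> and
  ridges make sense in every rank.\<close>

definition k_faces :: "'a set set \<Rightarrow> int \<Rightarrow> 'a set set" where
  "k_faces \<Delta> k = {X \<in> \<Delta>. int (card X) = k + 1}"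

definition facets :: "'a set set \<Rightarrow> 'a set set" where
  "facets \<Delta> = {X \<in> \<Delta>. \<forall>Y\<in>\<Delta>. X \<subseteq> Y \<longrightarrow> Y = X}"

definition pure :: "'a set set \<Rightarrow> nat \<Rightarrow> bool" where
  "pure \<Delta> n \<longleftrightarrow> (\<forall>X\<in>facets \<Delta>. card X = n)"

definition ridges :: "'a set set \<Rightarrow> nat \<Rightarrow> 'a set set" where
  "ridges \<Delta> n = k_faces \<Delta> (int n - 2)"

definition thin :: "'a set set \<Rightarrow> nat \<Rightarrow> bool" where
  "thin \<Delta> n \<longleftrightarrow> (\<forall>R\<in>ridges \<Delta> n. card {X \<in> facets \<Delta>. R \<subseteq> X} = 2)"

definition adjacent :: "'a set set \<Rightarrow> nat \<Rightarrow> 'a set \<Rightarrow> 'a set \<Rightarrow> bool" where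
  "adjacent \<Delta> n X Y \<longleftrightarrow> X \<in> facets \<Delta> \<and> Y \<in> facets \<Delta> \<and> X \<inter> Y \<in> ridges \<Delta> n"

text \<open>A path is given by the list of its vertices; its length is the number of its edges,
  i.e. one less than the length of the list.\<close>

definition facet_path :: "'a set set \<Rightarrow> nat \<Rightarrow> 'a set list \<Rightarrow> bool" where
  "facet_path \<Delta> n p \<longleftrightarrow>
     p \<noteq> [] \<and> set p \<subseteq> facets \<Delta> \<and> (\<forall>i. Suc i < length p \<longrightarrow> adjacent \<Delta> n (p ! i) (p ! Suc i))"

definition joins :: "'a set list \<Rightarrow> 'a set \<Rightarrow> 'a set \<Rightarrow> bool" where
  "joins p X Y \<longleftrightarrow> hd p = X \<and> last p = Y"

definition thin_chamber_complex :: "'a set \<Rightarrow> 'a set set \<Rightarrow> nat \<Rightarrow> bool" where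
  "thin_chamber_complex V \<Delta> n \<longleftrightarrow>
     simplicial_complex V \<Delta> \<and> pure \<Delta> n \<and> thin \<Delta> n \<and>
     (\<forall>X\<in>facets \<Delta>. \<forall>Y\<in>facets \<Delta>. \<exists>p. facet_path \<Delta> n p \<and> joins p X Y)"

definition facet_dist :: "'a set set \<Rightarrow> nat \<Rightarrow> 'a set \<Rightarrow> 'a set \<Rightarrow> nat" where
  "facet_dist \<Delta> n X Y = (LEAST m. \<exists>p. facet_path \<Delta> n p \<and> joins p X Y \<and> length p = Suc m)"

definition geodesic :: "'a set set \<Rightarrow> nat \<Rightarrow> 'a set list \<Rightarrow> bool" where
  "geodesic \<Delta> n p \<longleftrightarrow>
     facet_path \<Delta> n p \<and> length p = Suc (facet_dist \<Delta> n (hd p) (last p))"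


section \<open>Distance normality\<close>

definition distance_normal_pair :: "'a set set \<Rightarrow> nat \<Rightarrow> 'a set \<Rightarrow> 'a set \<Rightarrow> bool" where
  "distance_normal_pair \<Delta> n X Y \<longleftrightarrow>
     X \<in> facets \<Delta> \<and> Y \<in> facets \<Delta> \<and> facet_dist \<Delta> n X Y \<le> n \<and>
     int (facet_dist \<Delta> n X Y) = int n - int (card (X \<inter> Y))"

definition distance_normal_geodesic :: "'a set set \<Rightarrow> nat \<Rightarrow> 'a set list \<Rightarrow> bool" where
  "distance_normal_geodesic \<Delta> n p \<longleftrightarrow>
     geodesic \<Delta> n p \<and>
     (if facet_dist \<Delta> n (hd p) (last p) \<le> n
      then distance_normal_pair \<Delta> n (hd p) (last p)
      else \<forall>i<length p. \<forall>j<length p.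
             facet_dist \<Delta> n (p ! i) (p ! j) \<le> n \<longrightarrow>
             distance_normal_pair \<Delta> n (p ! i) (p ! j))"


section \<open>Flags and zigzags\<close>

text \<open>A flag is the list of its faces; the entry with index \<open>i\<close> is the \<open>i\<close>-face.
  By purity the maximal chains of nonempty faces are exactly the chains with one face
  in each of the dimensions \<open>0, \<dots>, n - 1\<close>.\<close>

definition flag :: "'a set set \<Rightarrow> nat \<Rightarrow> 'a set list \<Rightarrow> bool" where
  "flag \<Delta> n F \<longleftrightarrow>
     length F = n \<and> (\<forall>i<n. F ! i \<in> k_faces \<Delta> (int i)) \<and>
     (\<forall>i. Suc i < n \<longrightarrow> F ! i \<subset> F ! Suc i)"

text \<open>Existence and uniqueness of the flag below hold for \<open>i < n\<close>
  in a thin complex.\<close>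

definition flag_sigma :: "'a set set \<Rightarrow> nat \<Rightarrow> nat \<Rightarrow> 'a set list \<Rightarrow> 'a set list" where
  "flag_sigma \<Delta> n i F =
     (THE G. flag \<Delta> n G \<and> G ! i \<noteq> F ! i \<and> (\<forall>j<n. j \<noteq> i \<longrightarrow> G ! j = F ! j))"

definition flag_T :: "'a set set \<Rightarrow> nat \<Rightarrow> 'a set list \<Rightarrow> 'a set list" where
  "flag_T \<Delta> n F = fold (flag_sigma \<Delta> n) [0..<n] F"

definition flag_of :: "'a list \<Rightarrow> 'a set list" where
  "flag_of xs = map (\<lambda>i. set (take (Suc i) xs)) [0..<length xs]"

definition flag_reverse :: "'a set list \<Rightarrow> 'a set list" where
  "flag_reverse F = flag_of (rev (THE xs. flag_of xs = F))"

text \<open>Zigzags with a chosen starting flag. The zigzags themselves are the classes of these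
  sequences under the equivalence generated by shifts and reversal.\<close>

definition zigzag_seqs :: "'a set set \<Rightarrow> nat \<Rightarrow> (nat \<Rightarrow> 'a set list) set" where
  "zigzag_seqs \<Delta> n = {\<lambda>i. (flag_T \<Delta> n ^^ i) F | F. flag \<Delta> n F}"

definition is_shift :: "(nat \<Rightarrow> 'a set list) \<Rightarrow> (nat \<Rightarrow> 'a set list) \<Rightarrow> bool" where
  "is_shift Z Z' \<longleftrightarrow> (\<exists>j. \<forall>i. Z' i = Z (j + i))"

text \<open>If \<open>Z 0, \<dots>, Z (l - 1)\<close> is one period of \<open>Z\<close>, then the reverse has the period
  \<open>R (Z (l - 1)), \<dots>, R (Z 0)\<close>, where \<open>R\<close> is the reversal of flags.\<close>

definition is_reverse :: "(nat \<Rightarrow> 'a set list) \<Rightarrow> (nat \<Rightarrow> 'a set list) \<Rightarrow> bool" where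
  "is_reverse Z Z' \<longleftrightarrow>
     (\<exists>l>0. (\<forall>i. Z (i + l) = Z i) \<and> (\<forall>i. Z' i = flag_reverse (Z (l - 1 - i mod l))))"

definition zigzag_rel ::
    "'a set set \<Rightarrow> nat \<Rightarrow> ((nat \<Rightarrow> 'a set list) \<times> (nat \<Rightarrow> 'a set list)) set" where
  "zigzag_rel \<Delta> n =
     {(Z, Z'). equivclp (\<lambda>A B. A \<in> zigzag_seqs \<Delta> n \<and> B \<in> zigzag_seqs \<Delta> n \<and>
                               (is_shift A B \<or> is_reverse A B)) Z Z'}"

definition zigzags :: "'a set set \<Rightarrow> nat \<Rightarrow> (nat \<Rightarrow> 'a set list) set set" where
  "zigzags \<Delta> n = zigzag_seqs \<Delta> n // zigzag_rel \<Delta> n"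

text \<open>The facet of a flag is the last member of the chain \<open>{} \<subset> X\<^sub>0 \<subset> \<dots> \<subset> X\<^bsub>n-1\<^esub>\<close>. Prepending
  the empty face only matters for \<open>n = 0\<close>, where the flag is empty and the facet is \<open>{}\<close>.\<close>

definition shadow :: "(nat \<Rightarrow> 'a set list) \<Rightarrow> nat \<Rightarrow> 'a set" where
  "shadow Z i = last ({} # Z i)"

definition path_contained_in :: "'a set list \<Rightarrow> (nat \<Rightarrow> 'a set) \<Rightarrow> bool" where
  "path_contained_in p Y \<longleftrightarrow> (\<exists>j. \<forall>i<length p. Y (j + i) = p ! i)"

text \<open>A path lies in the shadow of a zigzag if it lies in the shadow of one of the sequences
  identified with that zigzag.\<close>

definition zigzags_containing ::
    "'a set set \<Rightarrow> nat \<Rightarrow> 'a set list \<Rightarrow> (nat \<Rightarrow> 'a set list) set set" where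
  "zigzags_containing \<Delta> n p =
     {C \<in> zigzags \<Delta> n. \<exists>Z\<in>C. path_contained_in p (shadow Z)}"

end

theory Submission
  imports Defs "HOL-Combinatorics.Multiset_Permutations"
begin

text \<open>A flag is the same thing as an ordering \<open>x\<^sub>0, \<dots>, x\<^bsub>n-1\<^esub>\<close> of a facet, and \<open>T\<close> turns it into
  \<open>x\<^sub>1, \<dots>, x\<^sub>n\<close>, where \<open>x\<^sub>n\<close> is the vertex opposite to \<open>x\<^sub>0\<close> across the ridge \<open>{x\<^sub>1, \<dots>, x\<^bsub>n-1\<^esub>}\<close>.
  A path of facets \<open>X\<^sub>0, \<dots>, X\<^sub>m\<close> removes one vertex \<open>v\<^sub>i\<close> in each step. The shadow of the
  zigzag of an ordering follows the path iff \<open>x\<^sub>i = v\<^sub>i\<close> for all \<open>i < m\<close>. Distance normality makes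
  any \<open>n\<close> consecutive \<open>v\<^sub>i\<close> distinct members of the facet at which they start and forces
  \<open>v\<^sub>i = x\<^sub>i\<close> for \<open>i \<ge> n\<close>, so that the first \<open>min n m\<close> entries of the ordering are prescribed and the
  others are free. Reversal only identifies further zigzags, which is harmless for upper bounds.\<close>

section \<open>Flags as orderings of facets\<close>

lemma length_flag_of [simp]: "length (flag_of xs) = length xs"
  by (simp add: flag_of_def)

lemma nth_flag_of [simp]: "i < length xs \<Longrightarrow> flag_of xs ! i = set (take (Suc i) xs)"
  by (simp add: flag_of_def)

lemma last_flag_of: "last ({} # flag_of xs) = set xs"
proof (cases "xs = []")
  case True
  then show ?thesis by (simp add: flag_of_def)
next
  case False
  then have "flag_of xs \<noteq> []" by (simp add: flag_of_def)
  then show ?thesis using False by (simp add: last_conv_nth)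
qed

section \<open>Facets, ridges and orderings in a thin complex\<close>

locale thin_complex =
  fixes V :: "'a set" and \<Delta> :: "'a set set" and n :: nat
  assumes complex: "simplicial_complex V \<Delta>"
    and pure: "pure \<Delta> n"
    and thin: "thin \<Delta> n"
begin

lemma finite_complex: "finite \<Delta>"
  using complex unfolding simplicial_complex_def by (meson finite_Pow_iff finite_subset)

lemma finite_face: "X \<in> \<Delta> \<Longrightarrow> finite X"
  using complex unfolding simplicial_complex_def by (meson PowD finite_subset subsetD)

lemma face_subset: "X \<in> \<Delta> \<Longrightarrow> Y \<subseteq> X \<Longrightarrow> Y \<in> \<Delta>"
  using complex unfolding simplicial_complex_def by blast

lemma facet_face: "X \<in> facets \<Delta> \<Longrightarrow> X \<in> \<Delta>"
  by (simp add: facets_def)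

lemma finite_facet: "X \<in> facets \<Delta> \<Longrightarrow> finite X"
  by (simp add: facet_face finite_face)

lemma card_facet: "X \<in> facets \<Delta> \<Longrightarrow> card X = n"
  using pure by (simp add: pure_def)

text \<open>Some maximal face contains \<open>X\<close>; purity gives it \<open>n\<close> elements
  too, so it equals \<open>X\<close>.\<close>

lemma facetI:
  assumes "X \<in> \<Delta>" "card X = n"
  shows "X \<in> facets \<Delta>"
proof -
  obtain Z where Z: "Z \<in> \<Delta>" "X \<subseteq> Z" "\<forall>Y\<in>\<Delta>. Z \<subseteq> Y \<longrightarrow> Z = Y"
    using finite_has_maximal2[OF finite_complex assms(1)] by auto
  then have "Z \<in> facets \<Delta>" by (auto simp: facets_def)
  moreover have "X = Z"
    using Z \<open>Z \<in> facets \<Delta>\<close> assms(2) card_facet finite_facet by (metis card_subset_eq)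
  ultimately show ?thesis by simp
qed

lemma card_facets_containing:
  assumes "X \<in> facets \<Delta>" "R \<subseteq> X" "Suc (card R) = n"
  shows "card {Y \<in> facets \<Delta>. R \<subseteq> Y} = 2"
proof -
  have "R \<in> ridges \<Delta> n"
    using assms facet_face face_subset by (auto simp: ridges_def k_faces_def)
  then show ?thesis using thin by (simp add: thin_def)
qed

lemma ex_opposite_facet:
  assumes "X \<in> facets \<Delta>" "R \<subseteq> X" "Suc (card R) = n"
  shows "\<exists>Y\<in>facets \<Delta>. R \<subseteq> Y \<and> Y \<noteq> X"
proof -
  obtain A B where AB: "{Y \<in> facets \<Delta>. R \<subseteq> Y} = {A, B}" "A \<noteq> B"
    using card_facets_containing[OF assms] by (auto simp: card_2_iff)
  have "A \<in> {Y \<in> facets \<Delta>. R \<subseteq> Y}" "B \<in> {Y \<in> facets \<Delta>. R \<subseteq> Y}"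
    unfolding AB(1) by simp_all
  then show ?thesis using AB(2) by (cases "A = X") auto
qed

text \<open>Together with \<open>ex_opposite_facet\<close> this is the form in which thinness is
  used: crossing a given ridge out of \<open>X\<close> is possible in exactly one way.\<close>

lemma opposite_facet_unique:
  assumes "X \<in> facets \<Delta>" "Y \<in> facets \<Delta>" "Z \<in> facets \<Delta>"
    and "R \<subseteq> X" "R \<subseteq> Y" "R \<subseteq> Z" "Suc (card R) = n" "Y \<noteq> X" "Z \<noteq> X"
  shows "Y = Z"
proof -
  obtain A B where AB: "{Y \<in> facets \<Delta>. R \<subseteq> Y} = {A, B}"
    using card_facets_containing[of X R] assms by (auto simp: card_2_iff)
  have "X \<in> {A, B}" "Y \<in> {A, B}" "Z \<in> {A, B}" unfolding AB[symmetric] using assms by simp_all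
  then show ?thesis using assms(8,9) by blast
qed

definition facet_ordering :: "'a list \<Rightarrow> bool" where
  "facet_ordering xs \<longleftrightarrow> distinct xs \<and> set xs \<in> facets \<Delta>"

lemma length_facet_ordering: "facet_ordering xs \<Longrightarrow> length xs = n"
  unfolding facet_ordering_def using card_facet distinct_card by metis

lemma flag_flag_of:
  assumes "facet_ordering xs"
  shows "flag \<Delta> n (flag_of xs)"
  unfolding flag_def
proof (intro conjI allI impI)
  have len: "length xs = n" using assms by (rule length_facet_ordering)
  have dist: "distinct xs" and fac: "set xs \<in> facets \<Delta>" using assms by (auto simp: facet_ordering_def)
  have card: "card (set (take k xs)) = k" if "k \<le> n" for k
    using that len dist by (simp add: distinct_card)
  show "length (flag_of xs) = n" using len by simp
  show "flag_of xs ! i \<in> k_faces \<Delta> (int i)" if "i < n" for i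
    using that len card[of "Suc i"] face_subset[OF facet_face[OF fac] set_take_subset]
    by (simp add: k_faces_def)
  show "flag_of xs ! i \<subset> flag_of xs ! Suc i" if i: "Suc i < n" for i
  proof -
    have "set (take (Suc i) xs) \<subseteq> set (take (Suc (Suc i)) xs)"
      by (simp add: set_take_subset_set_take)
    moreover have "set (take (Suc i) xs) \<noteq> set (take (Suc (Suc i)) xs)"
      using card[of "Suc i"] card[of "Suc (Suc i)"] i by force
    ultimately show ?thesis using i len by (simp add: psubset_eq)
  qed
qed

lemma flag_nth:
  assumes "flag \<Delta> n F" "i < n"
  shows "F ! i \<in> \<Delta>" "card (F ! i) = Suc i"
  using assms unfolding flag_def k_faces_def by force+

lemma flag_subset: "flag \<Delta> n F \<Longrightarrow> Suc i < n \<Longrightarrow> F ! i \<subseteq> F ! Suc i"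
  unfolding flag_def by blast

lemma card_Suc_superset:
  assumes "card B = Suc (card A)" "A \<subseteq> B"
  obtains x where "x \<notin> A" "B = insert x A"
proof -
  have "finite B" using assms(1) card.infinite by force
  then have "card (B - A) = 1"
    using assms card_Diff_subset[of A B] finite_subset[of A B] by simp
  then obtain x where "B - A = {x}" by (auto simp: card_1_singleton_iff)
  then have "x \<notin> A" "B = insert x A" using assms(2) by auto
  then show ?thesis by (rule that)
qed

text \<open>Each face of a flag has one vertex more than its predecessor, so the ordering grows by
  appending that new vertex.\<close>

lemma flag_prefix_ordering:
  assumes "flag \<Delta> n F" "k \<le> n"
  shows "\<exists>xs. distinct xs \<and> length xs = k \<and> (\<forall>i<k. set (take (Suc i) xs) = F ! i)"
  using assms(2)
proof (induction k)
  case 0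
  then show ?case by simp
next
  case (Suc k)
  then obtain xs where xs: "distinct xs" "length xs = k" "\<forall>i<k. set (take (Suc i) xs) = F ! i"
    by auto
  have "set xs \<subseteq> F ! k"
  proof (cases k)
    case (Suc j)
    then show ?thesis using xs flag_subset[OF assms(1), of j] \<open>Suc k \<le> n\<close> by force
  qed (use xs in simp)
  moreover have "card (F ! k) = Suc (card (set xs))"
    using xs flag_nth(2)[OF assms(1)] Suc.prems distinct_card by fastforce
  ultimately obtain x where "x \<notin> set xs" "F ! k = insert x (set xs)"
    using card_Suc_superset by metis
  then have "distinct (xs @ [x])" "length (xs @ [x]) = Suc k"
    "\<forall>i<Suc k. set (take (Suc i) (xs @ [x])) = F ! i"
    using xs by (auto simp: less_Suc_eq)
  then show ?case by blast
qed

lemma flag_ordering: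
  assumes "flag \<Delta> n F"
  obtains xs where "facet_ordering xs" "flag_of xs = F"
proof -
  obtain xs where xs: "distinct xs" "length xs = n" "\<forall>i<n. set (take (Suc i) xs) = F ! i"
    using flag_prefix_ordering[OF assms order_refl] by blast
  have "length F = n" using assms by (simp add: flag_def)
  then have "flag_of xs = F" using xs by (intro nth_equalityI) auto
  moreover have "set xs \<in> \<Delta>"
  \<comment> \<open>In rank 0 the flag has no last entry, and the facet is the empty face.\<close>
  proof (cases n)
    case 0
    then show ?thesis using xs complex by (simp add: simplicial_complex_def)
  next
    case (Suc k)
    then have "set xs = F ! k" using xs(2) xs(3)[rule_format, of k] by simp
    then show ?thesis using flag_nth(1)[OF assms, of k] Suc by simp
  qed
  then have "facet_ordering xs"
    using xs by (auto simp: facet_ordering_def distinct_card intro: facetI)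
  ultimately show ?thesis using that by blast
qed


section \<open>The operators on flags\<close>

text \<open>Below the top, the \<open>i\<close>-face lies between faces with \<open>i\<close> and
  \<open>i + 2\<close> vertices, which leaves only two choices; for the facet itself thinness gives
  the same count.\<close>

lemma flag_neighbour_unique:
  assumes F: "flag \<Delta> n F" and G: "flag \<Delta> n G" and H: "flag \<Delta> n H" and i: "i < n"
    and Gi: "G ! i \<noteq> F ! i" "\<forall>j<n. j \<noteq> i \<longrightarrow> G ! j = F ! j"
    and Hi: "H ! i \<noteq> F ! i" "\<forall>j<n. j \<noteq> i \<longrightarrow> H ! j = F ! j"
  shows "H = G"
proof -
  \<comment> \<open>The face just below dimension \<open>i\<close>, common to all three flags; for
    \<open>i = 0\<close> it is the empty face, which flags do not list.\<close>
  define A where "A = (if i = 0 then {} else F ! (i - 1))"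
  have cA: "card A = i"
    using flag_nth(2)[OF F, of "i - 1"] i by (simp add: A_def)
  have A_subset: "A \<subseteq> K ! i" if "flag \<Delta> n K" "\<forall>j<n. j \<noteq> i \<longrightarrow> K ! j = F ! j" for K
  proof (cases i)
    case (Suc k)
    then show ?thesis using flag_subset[OF that(1), of k] that(2) i by (simp add: A_def)
  qed (simp add: A_def)
  have sub: "A \<subseteq> F ! i" "A \<subseteq> G ! i" "A \<subseteq> H ! i"
    using A_subset F G H Gi Hi by simp_all
  have card: "card (F ! i) = Suc i" "card (G ! i) = Suc i" "card (H ! i) = Suc i"
    using flag_nth F G H i by simp_all
  have "G ! i = H ! i"
  proof (cases "Suc i = n")
    case True
    then have "F ! i \<in> facets \<Delta>" "G ! i \<in> facets \<Delta>" "H ! i \<in> facets \<Delta>"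
      using flag_nth F G H i card facetI by simp_all
    then show ?thesis
      using opposite_facet_unique[of "F ! i" "G ! i" "H ! i" A] sub cA True Gi Hi by simp
  next
    case False
    then have i': "Suc i < n" using i by simp
    define B where "B = F ! Suc i"
    have B: "finite B" "card B = i + 2" using flag_nth[OF F i'] finite_face by (simp_all add: B_def)
    have subB: "F ! i \<subseteq> B" "G ! i \<subseteq> B" "H ! i \<subseteq> B"
      using flag_subset[OF F i'] flag_subset[OF G i'] flag_subset[OF H i'] Gi Hi i'
      by (simp_all add: B_def)
    obtain f where f: "f \<notin> A" "F ! i = insert f A"
      using card_Suc_superset[of "F ! i" A] sub card cA by metis
    obtain g where g: "g \<notin> A" "G ! i = insert g A"
      using card_Suc_superset[of "G ! i" A] sub card cA by metis
    obtain h where h: "h \<notin> A" "H ! i = insert h A"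
      using card_Suc_superset[of "H ! i" A] sub card cA by metis
    \<comment> \<open>Otherwise \<open>f\<close>, \<open>g\<close>, \<open>h\<close> would be three
      distinct vertices outside \<open>A\<close>, too many for \<open>B\<close>.\<close>
    have "g = h"
    proof (rule ccontr)
      assume "g \<noteq> h"
      moreover have "f \<noteq> g" "f \<noteq> h" using f g h Gi Hi by auto
      moreover have "finite A" using B sub subB finite_subset by metis
      ultimately have "card (insert f (insert g (insert h A))) = i + 3"
        using f g h cA by simp
      moreover have "insert f (insert g (insert h A)) \<subseteq> B" using f g h subB by auto
      ultimately have "i + 3 \<le> i + 2" using card_mono[OF B(1)] B(2) by metis
      then show False by simp
    qed
    then show ?thesis using g h by simp
  qed
  then have "\<forall>j<n. H ! j = G ! j" using Gi Hi by metis
  moreover have "length G = n" "length H = n" using G H by (simp_all add: flag_def)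
  ultimately show ?thesis by (simp add: nth_equalityI)
qed

text \<open>Resolves the definite description: existence is settled by exhibiting \<open>G\<close>,
  uniqueness by the preceding lemma.\<close>

lemma flag_sigma_eqI:
  assumes "flag \<Delta> n F" "flag \<Delta> n G" "i < n"
    and "G ! i \<noteq> F ! i" "\<forall>j<n. j \<noteq> i \<longrightarrow> G ! j = F ! j"
  shows "flag_sigma \<Delta> n i F = G"
  unfolding flag_sigma_def
proof (rule the_equality)
  show "flag \<Delta> n G \<and> G ! i \<noteq> F ! i \<and> (\<forall>j<n. j \<noteq> i \<longrightarrow> G ! j = F ! j)"
    using assms(2,4,5) by simp
  show "H = G" if "flag \<Delta> n H \<and> H ! i \<noteq> F ! i \<and> (\<forall>j<n. j \<noteq> i \<longrightarrow> H ! j = F ! j)" for H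
    using that by (elim conjE) (rule flag_neighbour_unique[OF assms(1,2) _ assms(3-5)])
qed

text \<open>Swapping two neighbouring entries alters only the prefix that ends between them. This
  covers every operator except the one that replaces the facet.\<close>

lemma flag_sigma_swap:
  assumes "facet_ordering (as @ u # v # bs)"
  shows "flag_sigma \<Delta> n (length as) (flag_of (as @ u # v # bs)) = flag_of (as @ v # u # bs)"
proof (rule flag_sigma_eqI)
  have swap: "facet_ordering (as @ v # u # bs)"
    using assms by (auto simp: facet_ordering_def insert_commute)
  show "flag \<Delta> n (flag_of (as @ u # v # bs))" "flag \<Delta> n (flag_of (as @ v # u # bs))"
    using assms swap by (auto intro: flag_flag_of)
  have len: "length (as @ u # v # bs) = n" using assms by (rule length_facet_ordering)
  then show "length as < n" by simp
  show "flag_of (as @ v # u # bs) ! length as \<noteq> flag_of (as @ u # v # bs) ! length as"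
    using assms by (auto simp: facet_ordering_def)
  show "\<forall>j<n. j \<noteq> length as \<longrightarrow> flag_of (as @ v # u # bs) ! j = flag_of (as @ u # v # bs) ! j"
  proof (intro allI impI)
    fix j assume j: "j < n" "j \<noteq> length as"
    have "set (take (Suc j) (as @ v # u # bs)) = set (take (Suc j) (as @ u # v # bs))"
    proof (cases "j < length as")
      case False
      then obtain d where "Suc j = length as + Suc (Suc d)"
        using j(2) less_iff_Suc_add[of "length as" j] by auto
      then show ?thesis by auto
    qed simp
    then show "flag_of (as @ v # u # bs) ! j = flag_of (as @ u # v # bs) ! j"
      using j len by simp
  qed
qed

text \<open>The successive swaps carry the first entry \<open>x\<close> to the right, one place at a
  time.\<close>

lemma fold_flag_sigma:
  assumes "facet_ordering (x # xs)" "k \<le> length xs"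
  shows "fold (flag_sigma \<Delta> n) [0..<k] (flag_of (x # xs)) = flag_of (take k xs @ x # drop k xs)"
  using assms(2)
proof (induction k)
  case 0
  then show ?case by simp
next
  case (Suc k)
  then have k: "k < length xs" by simp
  have eq: "drop k xs = xs ! k # drop (Suc k) xs" using k by (simp add: Cons_nth_drop_Suc)
  have perm: "facet_ordering (take k xs @ x # xs ! k # drop (Suc k) xs)"
  proof -
    have "mset (take k xs @ x # xs ! k # drop (Suc k) xs) = mset (x # (take k xs @ drop k xs))"
      unfolding eq by simp
    then have m: "mset (take k xs @ x # xs ! k # drop (Suc k) xs) = mset (x # xs)" by simp
    show ?thesis
      using assms(1) mset_eq_setD[OF m] mset_eq_imp_distinct_iff[OF m]
      unfolding facet_ordering_def by simp
  qed
  have "fold (flag_sigma \<Delta> n) [0..<Suc k] (flag_of (x # xs))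
      = flag_sigma \<Delta> n k (flag_of (take k xs @ x # xs ! k # drop (Suc k) xs))"
    using Suc eq by simp
  also have "\<dots> = flag_of (take k xs @ xs ! k # x # drop (Suc k) xs)"
    using flag_sigma_swap[OF perm] k by simp
  finally show ?case using k by (simp add: take_Suc_conv_app_nth)
qed

text \<open>The first \<open>n - 1\<close> operators move \<open>x\<close> to the end; the last one
  changes only the facet and so exchanges \<open>x\<close> for \<open>y\<close>.\<close>

lemma flag_T_Cons:
  assumes "facet_ordering (x # xs)" "facet_ordering (xs @ [y])" "y \<noteq> x"
  shows "flag_T \<Delta> n (flag_of (x # xs)) = flag_of (xs @ [y])"
proof -
  have n: "n = Suc (length xs)" using length_facet_ordering[OF assms(1)] by simp
  have "facet_ordering (xs @ [x])" using assms(1) by (simp add: facet_ordering_def)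
  then have flags: "flag \<Delta> n (flag_of (xs @ [x]))" "flag \<Delta> n (flag_of (xs @ [y]))"
    using assms(2) flag_flag_of by auto
  have "flag_T \<Delta> n (flag_of (x # xs)) = flag_sigma \<Delta> n (length xs) (flag_of (xs @ [x]))"
    using fold_flag_sigma[OF assms(1) order_refl] by (simp add: flag_T_def n)
  also have "\<dots> = flag_of (xs @ [y])"
  proof (rule flag_sigma_eqI[OF flags])
    show "flag_of (xs @ [y]) ! length xs \<noteq> flag_of (xs @ [x]) ! length xs"
      using assms by (auto simp: facet_ordering_def)
  qed (use n in \<open>simp_all add: less_Suc_eq\<close>)
  finally show ?thesis .
qed

text \<open>The vertex \<open>y\<close> comes from the other facet through the ridge
  \<open>set xs\<close>.\<close>

lemma flag_T_step:
  assumes "facet_ordering (x # xs)"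
  obtains y where "y \<noteq> x" "facet_ordering (xs @ [y])"
    "flag_T \<Delta> n (flag_of (x # xs)) = flag_of (xs @ [y])"
proof -
  have n: "Suc (card (set xs)) = n"
    using length_facet_ordering[OF assms] assms by (simp add: facet_ordering_def distinct_card)
  obtain Y where Y: "Y \<in> facets \<Delta>" "set xs \<subseteq> Y" "Y \<noteq> set (x # xs)"
    using ex_opposite_facet[of "set (x # xs)" "set xs"] n assms
    by (auto simp: facet_ordering_def)
  then obtain y where y: "y \<notin> set xs" "Y = insert y (set xs)"
    using card_Suc_superset[of Y "set xs"] card_facet n by metis
  then have "facet_ordering (xs @ [y])" "y \<noteq> x"
    using Y assms by (auto simp: facet_ordering_def)
  then show ?thesis using flag_T_Cons[OF assms] that by blast
qed

lemma flag_flag_T: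
  assumes "flag \<Delta> n F"
  shows "flag \<Delta> n (flag_T \<Delta> n F)"
proof -
  obtain xs where xs: "facet_ordering xs" "flag_of xs = F" using flag_ordering[OF assms] .
  show ?thesis
  proof (cases xs)
    case Nil
    \<comment> \<open>In rank 0 no operator is applied, so \<open>flag_T\<close> is the
      identity.\<close>
    then have "n = 0" using length_facet_ordering[OF xs(1)] by simp
    then show ?thesis using assms by (simp add: flag_T_def)
  next
    case (Cons x ys)
    then show ?thesis using flag_T_step flag_flag_of xs by metis
  qed
qed

lemma flag_funpow_T: "flag \<Delta> n F \<Longrightarrow> flag \<Delta> n ((flag_T \<Delta> n ^^ i) F)"
  by (induction i) (auto intro: flag_flag_T)

section \<open>Zigzag sequences and the classes that contain a path\<close>

abbreviation zigzag :: "'a set list \<Rightarrow> nat \<Rightarrow> 'a set list" where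
  "zigzag F \<equiv> \<lambda>i. (flag_T \<Delta> n ^^ i) F"

lemma zigzag_in_seqs: "flag \<Delta> n F \<Longrightarrow> zigzag F \<in> zigzag_seqs \<Delta> n"
  by (auto simp: zigzag_seqs_def)

lemma zigzag_funpow: "zigzag (zigzag F j) i = zigzag F (j + i)"
  by (metis add.commute comp_apply funpow_add)

text \<open>A representative may meet the path at any offset \<open>j\<close>. Shifting it by
  \<open>j\<close> stays in the class and moves the path to the start, so the classes are indexed by
  the flags whose zigzag follows the path from time 0.\<close>

lemma zigzags_containing_eq:
  "zigzags_containing \<Delta> n p =
     (\<lambda>F. zigzag_rel \<Delta> n `` {zigzag F}) `
       {F. flag \<Delta> n F \<and> (\<forall>i<length p. shadow (zigzag F) i = p ! i)}"
proof (intro equalityI subsetI)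
  let ?R = "\<lambda>A B. A \<in> zigzag_seqs \<Delta> n \<and> B \<in> zigzag_seqs \<Delta> n \<and> (is_shift A B \<or> is_reverse A B)"
  fix C assume "C \<in> zigzags_containing \<Delta> n p"
  then obtain Z0 Z where Z0: "Z0 \<in> zigzag_seqs \<Delta> n" and C: "C = zigzag_rel \<Delta> n `` {Z0}"
    and Z: "Z \<in> C" "path_contained_in p (shadow Z)"
    by (auto simp: zigzags_containing_def zigzags_def quotient_def)
  have rel: "equivclp ?R Z0 Z" using Z C by (simp add: zigzag_rel_def)
  \<comment> \<open>The closure is reflexive on all sequences, but each generating step relates only
    zigzag sequences, so starting from \<open>Z0\<close> it never leaves them.\<close>
  then have "Z \<in> zigzag_seqs \<Delta> n"
    by (induction rule: equivclp_induct) (use Z0 in auto)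
  then obtain F where F: "flag \<Delta> n F" "Z = zigzag F" by (auto simp: zigzag_seqs_def)
  obtain j where j: "\<forall>i<length p. shadow Z (j + i) = p ! i"
    using Z by (auto simp: path_contained_in_def)
  define G where "G = zigzag F j"
  have G: "flag \<Delta> n G" unfolding G_def using F(1) by (rule flag_funpow_T)
  have GZ: "zigzag G i = Z (j + i)" for i unfolding G_def F(2) by (rule zigzag_funpow)
  then have "is_shift Z (zigzag G)" by (auto simp: is_shift_def)
  then have R: "?R Z (zigzag G)" using F G zigzag_in_seqs by blast
  have "equivclp ?R Z (zigzag G)" by (rule r_into_equivclp) (rule R)
  with rel have "equivclp ?R Z0 (zigzag G)" by (rule equivclp_trans)
  then have "C = zigzag_rel \<Delta> n `` {zigzag G}"
    unfolding C zigzag_rel_def by (auto intro: equivclp_trans equivclp_sym)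
  moreover have "\<forall>i<length p. shadow (zigzag G) i = p ! i"
    using j GZ by (simp add: shadow_def)
  ultimately show "C \<in> (\<lambda>F. zigzag_rel \<Delta> n `` {zigzag F}) `
       {F. flag \<Delta> n F \<and> (\<forall>i<length p. shadow (zigzag F) i = p ! i)}"
    using G by blast
next
  fix C assume "C \<in> (\<lambda>F. zigzag_rel \<Delta> n `` {zigzag F}) `
       {F. flag \<Delta> n F \<and> (\<forall>i<length p. shadow (zigzag F) i = p ! i)}"
  then obtain F where F: "flag \<Delta> n F" "\<forall>i<length p. shadow (zigzag F) i = p ! i"
    "C = zigzag_rel \<Delta> n `` {zigzag F}" by blast
  have "zigzag F \<in> C" unfolding F(3) by (simp add: zigzag_rel_def)
  moreover have "path_contained_in p (shadow (zigzag F))"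
    unfolding path_contained_in_def using F(2) by (intro exI[of _ 0]) simp
  moreover have "C \<in> zigzags \<Delta> n"
    unfolding F(3) zigzags_def using F(1) zigzag_in_seqs quotientI by metis
  ultimately show "C \<in> zigzags_containing \<Delta> n p" by (auto simp: zigzags_containing_def)
qed

lemma adjacentD:
  assumes "adjacent \<Delta> n X Y"
  shows "X \<in> facets \<Delta>" "Y \<in> facets \<Delta>" "Suc (card (X \<inter> Y)) = n" "card (X - Y) = 1"
proof -
  show fac: "X \<in> facets \<Delta>" "Y \<in> facets \<Delta>" using assms by (auto simp: adjacent_def)
  show n: "Suc (card (X \<inter> Y)) = n"
    using assms by (auto simp: adjacent_def ridges_def k_faces_def)
  show "card (X - Y) = 1"
    using n card_facet[OF fac(1)] finite_facet[OF fac(1)] by (simp add: card_Diff_subset_Int)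
qed

end


section \<open>Distances\<close>

text \<open>For \<open>k = 0\<close> the relation power would also relate sets that are not facets.\<close>

lemma ex_facet_path_iff:
  "(\<exists>p. facet_path \<Delta> n p \<and> joins p X Y \<and> length p = Suc k) \<longleftrightarrow>
     X \<in> facets \<Delta> \<and> (adjacent \<Delta> n ^^ k) X Y"
proof
  assume "\<exists>p. facet_path \<Delta> n p \<and> joins p X Y \<and> length p = Suc k"
  then obtain p where p: "facet_path \<Delta> n p" "joins p X Y" "length p = Suc k" by blast
  then have ends: "p ! 0 = X" "p ! k = Y" and ne: "p \<noteq> []"
    by (auto simp: joins_def hd_conv_nth last_conv_nth facet_path_def)
  have "\<forall>i<k. adjacent \<Delta> n (p ! i) (p ! Suc i)" using p by (simp add: facet_path_def)
  then have "(adjacent \<Delta> n ^^ k) X Y" unfolding relpowp_fun_conv using ends by blast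
  moreover have "X \<in> facets \<Delta>" using p ends(1) ne by (auto simp: facet_path_def)
  ultimately show "X \<in> facets \<Delta> \<and> (adjacent \<Delta> n ^^ k) X Y" by blast
next
  assume "X \<in> facets \<Delta> \<and> (adjacent \<Delta> n ^^ k) X Y"
  then obtain f where X: "X \<in> facets \<Delta>" and f: "f 0 = X" "f k = Y"
    "\<forall>i<k. adjacent \<Delta> n (f i) (f (Suc i))"
    unfolding relpowp_fun_conv by blast
  have fac: "f i \<in> facets \<Delta>" if "i \<le> k" for i
    using that f X by (cases i) (auto simp: adjacent_def)
  let ?p = "map f [0..<Suc k]"
  have "facet_path \<Delta> n ?p" "joins ?p X Y" "length ?p = Suc k"
    using fac f
    by (auto simp: facet_path_def joins_def hd_map last_map hd_upt last_upt simp del: upt_Suc)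
  then show "\<exists>p. facet_path \<Delta> n p \<and> joins p X Y \<and> length p = Suc k" by blast
qed

lemma facet_dist_le:
  "X \<in> facets \<Delta> \<Longrightarrow> (adjacent \<Delta> n ^^ k) X Y \<Longrightarrow> facet_dist \<Delta> n X Y \<le> k"
  unfolding facet_dist_def ex_facet_path_iff by (auto intro: Least_le)

lemma relpowp_facet_dist:
  "X \<in> facets \<Delta> \<Longrightarrow> (adjacent \<Delta> n ^^ k) X Y \<Longrightarrow> (adjacent \<Delta> n ^^ facet_dist \<Delta> n X Y) X Y"
  unfolding facet_dist_def ex_facet_path_iff by (metis (mono_tags, lifting) LeastI)

lemma facet_path_relpowp:
  assumes "facet_path \<Delta> n p" "i \<le> j" "j < length p"
  shows "(adjacent \<Delta> n ^^ (j - i)) (p ! i) (p ! j)"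
  unfolding relpowp_fun_conv
  by (rule exI[of _ "\<lambda>k. p ! (i + k)"]) (use assms in \<open>auto simp: facet_path_def\<close>)

text \<open>A shortcut between two vertices of a geodesic would shorten the whole geodesic.\<close>

lemma geodesic_facet_dist:
  assumes "geodesic \<Delta> n p" "i \<le> j" "j < length p"
  shows "facet_dist \<Delta> n (p ! i) (p ! j) = j - i"
proof (rule antisym)
  have path: "facet_path \<Delta> n p" and len: "length p = Suc (facet_dist \<Delta> n (hd p) (last p))"
    using assms(1) by (auto simp: geodesic_def)
  define m where "m = facet_dist \<Delta> n (hd p) (last p)"
  have fac: "p ! k \<in> facets \<Delta>" if "k < length p" for k
    using that path nth_mem by (auto simp: facet_path_def)
  have "length p = Suc m" using len by (simp add: m_def)
  moreover from this have "p \<noteq> []" by auto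
  ultimately have ends: "hd p = p ! 0" "last p = p ! m"
    by (simp_all add: hd_conv_nth last_conv_nth)
  have ij: "(adjacent \<Delta> n ^^ (j - i)) (p ! i) (p ! j)"
    using facet_path_relpowp[OF path assms(2,3)] .
  have fi: "p ! i \<in> facets \<Delta>" using fac assms by simp
  show "facet_dist \<Delta> n (p ! i) (p ! j) \<le> j - i" by (rule facet_dist_le[OF fi ij])
  define d where "d = facet_dist \<Delta> n (p ! i) (p ! j)"
  have jm: "j \<le> m" using assms len by (simp add: m_def)
  have "(adjacent \<Delta> n ^^ i) (p ! 0) (p ! i)" "(adjacent \<Delta> n ^^ (m - j)) (p ! j) (p ! m)"
    using facet_path_relpowp[OF path, of 0 i] facet_path_relpowp[OF path, of j m] assms len jm
    by (simp_all add: m_def)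
  moreover have "(adjacent \<Delta> n ^^ d) (p ! i) (p ! j)"
    unfolding d_def by (rule relpowp_facet_dist[OF fi ij])
  \<comment> \<open>The stretch from \<open>i\<close> to \<open>j\<close> is replaced by a shortest
    path of length \<open>d\<close>.\<close>
  ultimately have "(adjacent \<Delta> n ^^ (i + d + (m - j))) (p ! 0) (p ! m)"
    unfolding relpowp_add by blast
  then have "facet_dist \<Delta> n (p ! 0) (p ! m) \<le> i + d + (m - j)"
    by (rule facet_dist_le[OF fac, rotated]) (simp add: len)
  moreover have "m = facet_dist \<Delta> n (p ! 0) (p ! m)" using m_def unfolding ends .
  ultimately have "m \<le> i + d + (m - j)" by simp
  then show "j - i \<le> facet_dist \<Delta> n (p ! i) (p ! j)" using jm assms(2) unfolding d_def by linarith
qed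


section \<open>Distance normal paths\<close>

text \<open>The assumption \<open>card_diff\<close> unites the two cases of distance normality: over
  at most \<open>n\<close> steps, every step removes a further vertex of the facet at which the
  stretch starts.\<close>

locale normal_path = thin_complex +
  fixes X :: "nat \<Rightarrow> 'a set" and m :: nat
  assumes start: "X 0 \<in> facets \<Delta>"
    and step: "i < m \<Longrightarrow> adjacent \<Delta> n (X i) (X (Suc i))"
    and card_diff: "a \<le> b \<Longrightarrow> b \<le> m \<Longrightarrow> b - a \<le> n \<Longrightarrow> card (X a - X b) = b - a"
begin

lemma facet_X: "i \<le> m \<Longrightarrow> X i \<in> facets \<Delta>"
  by (cases i) (use start step adjacentD(2) Suc_le_lessD in blast)+

definition v :: "nat \<Rightarrow> 'a" where
  "v i = the_elem (X i - X (Suc i))"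

lemma diff_eq_v: "i < m \<Longrightarrow> X i - X (Suc i) = {v i}"
  using adjacentD(4)[OF step] unfolding v_def by (metis card_1_singletonE the_elem_eq)

lemma v_eqI: "i < m \<Longrightarrow> x \<in> X i \<Longrightarrow> x \<notin> X (Suc i) \<Longrightarrow> x = v i"
  using diff_eq_v[of i] by auto

text \<open>If step \<open>i\<close> removed a vertex outside \<open>X a\<close>, the number of
  vertices of \<open>X a\<close> lost so far would not grow in that step, against
  \<open>card_diff\<close>.\<close>

lemma v_mem:
  assumes "i < m" "a \<le> i" "i < a + n"
  shows "v i \<in> X a"
proof (rule ccontr)
  assume "v i \<notin> X a"
  then have "X a - X (Suc i) \<subseteq> X a - X i" using v_eqI[OF assms(1)] by auto
  moreover have "finite (X a - X i)" using facet_X[of a] assms finite_facet by simp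
  ultimately have "card (X a - X (Suc i)) \<le> card (X a - X i)" by (rule card_mono[rotated])
  then show False using card_diff[of a "Suc i"] card_diff[of a i] assms by simp
qed

text \<open>After \<open>n\<close> steps all vertices of \<open>X i\<close> are gone, so
  \<open>X i\<close> is disjoint from \<open>X (i + n)\<close>, where \<open>v (i + n)\<close>
  lies.\<close>

lemma v_not_mem:
  assumes "i + n < m"
  shows "v (i + n) \<notin> X i"
proof -
  have fac: "X i \<in> facets \<Delta>" using facet_X assms by simp
  have "card (X i - X (i + n)) = card (X i)"
    using card_diff[of i "i + n"] assms card_facet[OF fac] by simp
  then have "X i - X (i + n) = X i"
    using finite_facet[OF fac] by (intro card_subset_eq) auto
  then show ?thesis using diff_eq_v[OF assms] by blast
qed

text \<open>For \<open>i < j\<close> the vertex \<open>v j\<close> still belongs to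
  \<open>X (Suc i)\<close>, from which \<open>v i\<close> has been removed.\<close>

lemma inj_on_v: "inj_on v {..<min n m}"
proof -
  have "v i \<noteq> v j" if "i < j" "j < n" "j < m" for i j
    using v_mem[of j "Suc i"] diff_eq_v[of i] that by force
  then show ?thesis by (intro linorder_inj_onI) auto
qed

section \<open>The starting orderings that follow the path, and their number\<close>

text \<open>The bound \<open>min n m\<close> is needed because the path may have more steps than an
  ordering has entries.\<close>

definition orderings :: "'a list set" where
  "orderings = {xs. facet_ordering xs \<and> set xs = X 0 \<and> (\<forall>k<min n m. xs ! k = v k)}"

lemma orderings_eq:
  "orderings = (\<lambda>ps. map v [0..<min n m] @ ps) ` permutations_of_set (X 0 - v ` {..<min n m})"
proof (intro equalityI subsetI)
  fix xs assume "xs \<in> orderings"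
  then have xs: "distinct xs" "length xs = n" "set xs = X 0" "\<forall>k<min n m. xs ! k = v k"
    using length_facet_ordering by (auto simp: orderings_def facet_ordering_def)
  have take: "take (min n m) xs = map v [0..<min n m]"
    using xs by (intro nth_equalityI) auto
  let ?ps = "drop (min n m) xs"
  have split: "xs = map v [0..<min n m] @ ?ps" using take append_take_drop_id by metis
  have "set (take (min n m) xs) = v ` {..<min n m}"
    unfolding take by (simp add: atLeast0LessThan)
  moreover have "set (take (min n m) xs) \<inter> set ?ps = {}"
    using xs(1) by (metis append_take_drop_id distinct_append)
  moreover have "set (take (min n m) xs) \<union> set ?ps = X 0"
    using xs(3) by (metis append_take_drop_id set_append)
  ultimately have "set ?ps = X 0 - v ` {..<min n m}" by blast
  then have "?ps \<in> permutations_of_set (X 0 - v ` {..<min n m})"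
    using xs(1) by (simp add: permutations_of_set_def)
  then show "xs \<in> (\<lambda>ps. map v [0..<min n m] @ ps) ` permutations_of_set (X 0 - v ` {..<min n m})"
    using split by blast
next
  fix xs
  assume "xs \<in> (\<lambda>ps. map v [0..<min n m] @ ps) ` permutations_of_set (X 0 - v ` {..<min n m})"
  then obtain ps where ps: "xs = map v [0..<min n m] @ ps" "distinct ps"
    "set ps = X 0 - v ` {..<min n m}"
    by (auto simp: permutations_of_set_def)
  have "v ` {..<min n m} \<subseteq> X 0" using v_mem[of _ 0] by auto
  then have "set xs = X 0" using ps by (auto simp: atLeast0LessThan)
  moreover have "distinct xs"
    using ps inj_on_v by (auto simp: distinct_map atLeast0LessThan)
  moreover have "\<forall>k<min n m. xs ! k = v k" using ps(1) by (simp add: nth_append)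
  ultimately show "xs \<in> orderings" using start by (simp add: orderings_def facet_ordering_def)
qed

text \<open>With truncated subtraction the bound is \<open>fact 0 = 1\<close> when
  \<open>m > n\<close>, so it also serves the uniqueness assertion.\<close>

lemma orderings_nonempty: "orderings \<noteq> {}"
  and finite_orderings: "finite orderings"
  and card_orderings_le: "card orderings \<le> fact (n - m)"
proof -
  let ?A = "X 0 - v ` {..<min n m}"
  have A: "finite ?A" using finite_facet[OF start] by simp
  show "orderings \<noteq> {}" unfolding orderings_eq using A by simp
  show "finite orderings" unfolding orderings_eq using A by simp
  have "v ` {..<min n m} \<subseteq> X 0" using v_mem[of _ 0] by auto
  then have "card ?A = n - min n m"
    using card_facet[OF start] card_image[OF inj_on_v] by (simp add: card_Diff_subset)
  then have "card (permutations_of_set ?A) = fact (n - m)"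
    using A by (simp add: min_def split: if_splits)
  then show "card orderings \<le> fact (n - m)"
    unfolding orderings_eq using card_image_le[of "permutations_of_set ?A"] A by simp
qed

text \<open>The induction carries along that the current ordering lists the vertices about to be
  removed, as far as the path prescribes them. Hence \<open>flag_T\<close> drops \<open>v i\<close>,
  and thinness forces the next facet.\<close>

lemma follows_path:
  assumes "xs \<in> orderings" "i \<le> m"
  shows "\<exists>ys. zigzag (flag_of xs) i = flag_of ys \<and> facet_ordering ys \<and> set ys = X i \<and>
           (\<forall>k<n. i + k < m \<longrightarrow> ys ! k = v (i + k))"
  using assms(2)
proof (induction i)
  case 0
  then show ?case using assms(1) by (auto simp: orderings_def)
next
  case (Suc i)
  then have i: "i < m" by simp
  obtain ys where ys: "zigzag (flag_of xs) i = flag_of ys" "facet_ordering ys" "set ys = X i"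
    "\<forall>k<n. i + k < m \<longrightarrow> ys ! k = v (i + k)"
    using Suc by auto
  have n: "n > 0" "length ys = n" using adjacentD(3)[OF step[OF i]] length_facet_ordering[OF ys(2)] by auto
  then obtain zs where zs: "ys = v i # zs" using ys(4)[rule_format, of 0] i by (cases ys) auto
  obtain y where y: "y \<noteq> v i" "facet_ordering (zs @ [y])"
    "flag_T \<Delta> n (flag_of (v i # zs)) = flag_of (zs @ [y])"
    using flag_T_step ys(2) zs by metis
  have set_zs: "set zs = X i - {v i}" using zs ys(2,3) by (auto simp: facet_ordering_def)
  have next_eq: "set (zs @ [y]) = X (Suc i)"
  \<comment> \<open>Both facets lie across the ridge \<open>set zs\<close> from
    \<open>X i\<close>.\<close>
  proof (rule opposite_facet_unique[of "X i" _ _ "set zs"])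
    show "set zs \<subseteq> X (Suc i)" using set_zs diff_eq_v[OF i] by blast
    show "Suc (card (set zs)) = n"
      using n zs ys(2) by (simp add: facet_ordering_def distinct_card)
    show "set (zs @ [y]) \<noteq> X i" "X (Suc i) \<noteq> X i"
      using y(1) set_zs diff_eq_v[OF i] by auto
  qed (use facet_X i set_zs y(2) in \<open>auto simp: facet_ordering_def\<close>)
  have "\<forall>k<n. Suc i + k < m \<longrightarrow> (zs @ [y]) ! k = v (Suc i + k)"
  proof (intro allI impI)
    fix k assume k: "k < n" "Suc i + k < m"
    show "(zs @ [y]) ! k = v (Suc i + k)"
    proof (cases "k < length zs")
      case True
      then show ?thesis using ys(4)[rule_format, of "Suc k"] zs n k by (simp add: nth_append)
    next
      case False
      \<comment> \<open>The entry just appended: \<open>v (i + n)\<close> is in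
        \<open>X (Suc i)\<close> but not in \<open>X i\<close>, and \<open>y\<close> is the only
        candidate.\<close>
      then have kn: "k = length zs" "Suc i + k = i + n" using k zs n by simp_all
      have "v (i + n) \<in> X (Suc i)" "v (i + n) \<notin> X i"
        using v_mem[of "i + n" "Suc i"] v_not_mem[of i] k kn n by auto
      then have "v (i + n) = y" unfolding next_eq[symmetric] ys(3)[symmetric] zs by auto
      then show ?thesis unfolding kn(2) using kn(1) by simp
    qed
  qed
  moreover have "zigzag (flag_of xs) (Suc i) = flag_of (zs @ [y])" using ys(1) zs y(3) by simp
  ultimately show ?case using y(2) next_eq by blast
qed

text \<open>During the first \<open>n\<close> steps the head of the current ordering is still an
  entry of \<open>xs\<close>, and the head is the vertex that the path loses next.\<close>

lemma path_determines_prefix: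
  assumes xs: "facet_ordering xs" and "i \<le> min n m"
    and path: "\<forall>i\<le>m. shadow (zigzag (flag_of xs)) i = X i"
  shows "\<exists>ys. zigzag (flag_of xs) i = flag_of ys \<and> facet_ordering ys \<and>
           (\<forall>k. i + k < n \<longrightarrow> ys ! k = xs ! (i + k)) \<and> (\<forall>k<i. xs ! k = v k)"
  using assms(2)
proof (induction i)
  case 0
  then show ?case using xs by auto
next
  case (Suc i)
  then have i: "i < n" "i < m" by simp_all
  obtain ys where ys: "zigzag (flag_of xs) i = flag_of ys" "facet_ordering ys"
    "\<forall>k. i + k < n \<longrightarrow> ys ! k = xs ! (i + k)" "\<forall>k<i. xs ! k = v k"
    using Suc by auto
  then obtain x zs where zs: "ys = x # zs"
    using length_facet_ordering[of ys] i by (cases ys) auto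
  have len: "length zs = n - 1" using length_facet_ordering[OF ys(2)] zs by simp
  obtain y where y: "y \<noteq> x" "facet_ordering (zs @ [y])"
    "flag_T \<Delta> n (flag_of (x # zs)) = flag_of (zs @ [y])"
    using flag_T_step ys(2) zs by metis
  then have T: "zigzag (flag_of xs) (Suc i) = flag_of (zs @ [y])" using ys zs by simp
  have "X i = set (x # zs)" "X (Suc i) = set (zs @ [y])"
    using path[rule_format, of i] path[rule_format, of "Suc i"] i ys(1) T zs
    unfolding shadow_def by (simp_all only: last_flag_of less_imp_le Suc_leI)
  moreover have "x \<notin> set zs" using ys(2) zs by (simp add: facet_ordering_def)
  ultimately have "x \<in> X i - X (Suc i)" using y(1) by auto
  then have "x = v i" using diff_eq_v[OF i(2)] by simp
  moreover have "x = xs ! i" using ys(3)[rule_format, of 0] zs i by simp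
  ultimately have "\<forall>k<Suc i. xs ! k = v k" using ys(4) by (simp add: less_Suc_eq)
  moreover have "\<forall>k. Suc i + k < n \<longrightarrow> (zs @ [y]) ! k = xs ! (Suc i + k)"
  proof (intro allI impI)
    fix k assume k: "Suc i + k < n"
    then have "k < length zs" using len by arith
    with k show "(zs @ [y]) ! k = xs ! (Suc i + k)"
      using ys(3)[rule_format, of "Suc k"] zs len by (simp add: nth_append)
  qed
  ultimately show ?case using T y(2) by blast
qed

lemma flags_following_path:
  "{F. flag \<Delta> n F \<and> (\<forall>i\<le>m. shadow (zigzag F) i = X i)} = flag_of ` orderings"
proof (intro equalityI subsetI)
  fix F assume "F \<in> {F. flag \<Delta> n F \<and> (\<forall>i\<le>m. shadow (zigzag F) i = X i)}"
  then have F: "flag \<Delta> n F" "\<forall>i\<le>m. shadow (zigzag F) i = X i" by auto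
  obtain xs where xs: "facet_ordering xs" "flag_of xs = F" using flag_ordering[OF F(1)] .
  have "\<forall>k<min n m. xs ! k = v k"
    using path_determines_prefix[OF xs(1) order_refl] F(2) xs(2) by blast
  moreover have "set xs = X 0"
    using F(2)[rule_format, of 0] last_flag_of[of xs] xs(2) by (simp add: shadow_def)
  ultimately have "xs \<in> orderings" using xs(1) by (simp add: orderings_def)
  then show "F \<in> flag_of ` orderings" using xs(2) by blast
next
  fix F assume "F \<in> flag_of ` orderings"
  then obtain xs where xs: "xs \<in> orderings" "F = flag_of xs" by blast
  have "shadow (zigzag F) i = X i" if "i \<le> m" for i
    using follows_path[OF xs(1) that] last_flag_of xs(2) unfolding shadow_def by metis
  moreover have "flag \<Delta> n F" using xs flag_flag_of by (simp add: orderings_def)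
  ultimately show "F \<in> {F. flag \<Delta> n F \<and> (\<forall>i\<le>m. shadow (zigzag F) i = X i)}" by blast
qed

end

section \<open>From distance normal geodesics to normal paths\<close>

context thin_complex
begin

text \<open>Each adjacency removes just one vertex.\<close>

lemma card_diff_path_le:
  assumes "facet_path \<Delta> n p" "i \<le> j" "j < length p"
  shows "card (p ! i - p ! j) \<le> j - i"
  using assms(2,3)
proof (induction j rule: dec_induct)
  case base
  then show ?case by simp
next
  case (step j)
  have adj: "adjacent \<Delta> n (p ! j) (p ! Suc j)" using assms(1) step by (simp add: facet_path_def)
  have fin: "finite (p ! k)" if "k < length p" for k
    using assms(1) nth_mem[OF that] finite_facet by (auto simp: facet_path_def)
  have "card (p ! i - p ! Suc j) \<le> card ((p ! i - p ! j) \<union> (p ! j - p ! Suc j))"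
    using fin step by (intro card_mono) auto
  also have "\<dots> \<le> card (p ! i - p ! j) + 1"
    using card_Un_le[of "p ! i - p ! j" "p ! j - p ! Suc j"] adjacentD(4)[OF adj] by simp
  finally show ?case using step by simp
qed

lemma distance_normal_pair_card_diff:
  assumes "distance_normal_pair \<Delta> n A B"
  shows "card (A - B) = facet_dist \<Delta> n A B"
proof -
  have A: "A \<in> facets \<Delta>" using assms by (simp add: distance_normal_pair_def)
  have "card (A - B) = n - card (A \<inter> B)"
    using card_facet[OF A] finite_facet[OF A] by (simp add: card_Diff_subset_Int)
  then show ?thesis using assms by (auto simp: distance_normal_pair_def)
qed

text \<open>For \<open>m > n\<close> normality of the pairs is part of the definition. For
  \<open>m \<le> n\<close> it is given only for the end points and has to be passed on to all pairs
  in between.\<close>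

lemma distance_normal_geodesic_normal_path:
  assumes normal: "distance_normal_geodesic \<Delta> n p" and len: "length p = Suc m"
  shows "normal_path V \<Delta> n (\<lambda>i. p ! i) m"
proof unfold_locales
  have geo: "geodesic \<Delta> n p" using normal by (simp add: distance_normal_geodesic_def)
  then have path: "facet_path \<Delta> n p" by (simp add: geodesic_def)
  have fac: "p ! k \<in> facets \<Delta>" if "k \<le> m" for k
    using that path len nth_mem[of k p] by (auto simp: facet_path_def)
  show "p ! 0 \<in> facets \<Delta>" using fac by simp
  show "adjacent \<Delta> n (p ! i) (p ! Suc i)" if "i < m" for i
    using that path len by (simp add: facet_path_def)
  have ne: "p \<noteq> []" using len by auto
  have ends: "hd p = p ! 0" "last p = p ! m"
    using len ne by (simp_all add: hd_conv_nth last_conv_nth)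
  have dist: "facet_dist \<Delta> n (p ! i) (p ! j) = j - i" if "i \<le> j" "j \<le> m" for i j
    using geodesic_facet_dist[OF geo] that len by simp
  fix a b assume ab: "a \<le> b" "b \<le> m" "b - a \<le> n"
  show "card (p ! a - p ! b) = b - a"
  proof (cases "m \<le> n")
    case True
    then have "distance_normal_pair \<Delta> n (p ! 0) (p ! m)"
      using normal dist[of 0 m] unfolding distance_normal_geodesic_def ends by simp
    then have "m = card (p ! 0 - p ! m)"
      using distance_normal_pair_card_diff dist[of 0 m] by simp
    \<comment> \<open>A vertex lost between the ends is lost on one of the three stretches. The
      outer two account for at most \<open>a\<close> and \<open>m - b\<close> of the
      \<open>m\<close> lost vertices, which leaves at least \<open>b - a\<close> for the middle
      one.\<close>
    also have "\<dots> \<le> card ((p ! 0 - p ! a) \<union> (p ! a - p ! b) \<union> (p ! b - p ! m))"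
      using fac[of 0] fac[of a] fac[of b] ab finite_facet by (intro card_mono) auto
    also have "\<dots> \<le> card (p ! 0 - p ! a) + card (p ! a - p ! b) + card (p ! b - p ! m)"
      by (meson add_le_mono1 card_Un_le order_trans)
    also have "\<dots> \<le> a + card (p ! a - p ! b) + (m - b)"
      using card_diff_path_le[OF path, of 0 a] card_diff_path_le[OF path, of b m] ab len by simp
    finally have "b - a \<le> card (p ! a - p ! b)" using ab by linarith
    moreover have "card (p ! a - p ! b) \<le> b - a"
      using card_diff_path_le[OF path, of a b] ab len by simp
    ultimately show ?thesis by simp
  next
    case False
    then have "distance_normal_pair \<Delta> n (p ! a) (p ! b)"
      using normal dist[of 0 m] dist[of a b] ab len
      unfolding distance_normal_geodesic_def ends by simp
    then show ?thesis using distance_normal_pair_card_diff dist ab by simp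
  qed
qed

end

section \<open>Counting the zigzags through a distance normal geodesic\<close>

theorem theorem1:
  fixes V :: "'a set" and \<Delta> :: "'a set set" and n m :: nat and p :: "'a set list"
  assumes "thin_chamber_complex V \<Delta> n"
    and "distance_normal_geodesic \<Delta> n p"
    and "length p = Suc m"
  shows "zigzags_containing \<Delta> n p \<noteq> {} \<and>
    (m \<le> n \<longrightarrow> finite (zigzags_containing \<Delta> n p) \<and>
                card (zigzags_containing \<Delta> n p) \<le> fact (n - m)) \<and>
    (m > n \<longrightarrow> (\<exists>!C. C \<in> zigzags_containing \<Delta> n p))"
proof -
  interpret thin_complex V \<Delta> n
    using assms(1) by unfold_locales (auto simp: thin_chamber_complex_def)
  interpret normal_path V \<Delta> n "\<lambda>i. p ! i" m
    using distance_normal_geodesic_normal_path[OF assms(2,3)] .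
  let ?C = "zigzags_containing \<Delta> n p"
  \<comment> \<open>Different orderings may give the same class, for instance by reversal; being an
    image suffices for existence and for upper bounds.\<close>
  have eq: "?C = (\<lambda>xs. zigzag_rel \<Delta> n `` {zigzag (flag_of xs)}) ` orderings"
    using flags_following_path
    unfolding zigzags_containing_eq assms(3) less_Suc_eq_le by (simp add: image_image)
  have ne: "?C \<noteq> {}" and fin: "finite ?C"
    unfolding eq using orderings_nonempty finite_orderings by auto
  have card: "card ?C \<le> fact (n - m)"
    unfolding eq using card_image_le[OF finite_orderings] card_orderings_le order_trans by blast
  have "\<exists>!C. C \<in> ?C" if "m > n"
  proof -
    \<comment> \<open>Here \<open>n - m = 0\<close>, so there is at most one class, and
      \<open>ne\<close> supplies one.\<close>
    have "card ?C = 1"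
      using card that ne fin by (simp add: le_Suc_eq)
    then show ?thesis by (auto simp: card_1_singleton_iff)
  qed
  then show ?thesis using ne fin card by blast
qed

end
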